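(* Let $M$ be a pointed metric space, let $Y$ be a Banach space, and let $K$ be a nonempty compact Hausdorff topological space. Assume that $\mathrm{LipSNA}(M,C(K,Y))$ is dense in $\mathrm{Lip}_0(M,C(K,Y))$. Then $\mathrm{LipSNA}(M,Y)$ is dense in $\mathrm{Lip}_0(M,Y)$.
   Context: All metric spaces are complete and all Banach spaces are real. A pointed metric space is a metric space $(M,d)$ with a distinguished point $0\in M$. $\mathrm{Lip}_0(M,Y)$ is the Banach space of Lipschitz maps $F\colon M\to Y$ with $F(0)=0$, with norm $\|F\|_L=\sup\{\|F(p)-F(q)\|/d(p,q)\colon p\neq q\}$. $F$ strongly attains its norm if there are $p\neq q$ in $M$ with $\|F(p)-F(q)\|/d(p,q)=\|F\|_L$; $\mathrm{LipSNA}(M,Y)$ is the set of such maps. Density is with respect to $\|\cdot\|_L$. $C(K,Y)$ is the Banach space of continuous functions from $K$ to $Y$ with the supremum norm. *)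

theory Defs
  imports "HOL-Analysis.Analysis"
begin

text \<open>The argument \<open>z\<close> is the distinguished point of the metric space.\<close>

definition Lip0 :: "'m::metric_space \<Rightarrow> ('m \<Rightarrow> 'y::real_normed_vector) set" where
  "Lip0 z = {F. F z = 0 \<and> (\<exists>L. L-lipschitz_on UNIV F)}"

text \<open>The supremum is over nonnegative reals, so inserting \<open>0\<close> changes it only for a one-point space,
  where no pairs \<open>p \<noteq> q\<close> exist and the norm of the zero map must be \<open>0\<close> (\<open>Sup {}\<close> is unspecified
  on the reals).\<close>

definition lip_norm :: "('m::metric_space \<Rightarrow> 'y::real_normed_vector) \<Rightarrow> real" where
  "lip_norm F = Sup (insert 0 {norm (F p - F q) / dist p q | p q. p \<noteq> q})"

definition strongly_attains_norm :: "('m::metric_space \<Rightarrow> 'y::real_normed_vector) \<Rightarrow> bool" where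
  "strongly_attains_norm F \<longleftrightarrow> (\<exists>p q. p \<noteq> q \<and> norm (F p - F q) / dist p q = lip_norm F)"

definition LipSNA :: "'m::metric_space \<Rightarrow> ('m \<Rightarrow> 'y::real_normed_vector) set" where
  "LipSNA z = {F \<in> Lip0 z. strongly_attains_norm F}"

definition dense_in_Lip0 ::
    "'m::metric_space \<Rightarrow> ('m \<Rightarrow> 'y::real_normed_vector) set \<Rightarrow> bool" where
  "dense_in_Lip0 z S \<longleftrightarrow>
     S \<subseteq> Lip0 z \<and> (\<forall>F\<in>Lip0 z. \<forall>e>0. \<exists>G\<in>S. lip_norm (\<lambda>x. F x - G x) < e)"

text \<open>For a compact space \<open>'k\<close> every continuous function is bounded, so the type
  \<open>'k \<Rightarrow>\<^sub>C 'y\<close> of bounded continuous functions with its supremum norm is the space C(K,Y).\<close>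

lemma bcontfun_eq_continuous_if_compact:
  assumes "compact (UNIV :: 'k::topological_space set)"
  shows "(bcontfun :: ('k \<Rightarrow> 'y::metric_space) set) = {f. continuous_on UNIV f}"
  using assms by (auto simp: bcontfun_def intro: compact_imp_bounded compact_continuous_image)

end

theory Submission
  imports Defs
begin

text \<open>Embed \<open>Y\<close> into \<open>C(K,Y)\<close> as the constant functions and approximate the image of \<open>F\<close> by a
  norm-attaining \<open>G\<close>, attaining at \<open>p \<noteq> q\<close>. By compactness \<open>\<parallel>G p - G q\<parallel>\<close> is attained at some
  point \<open>k\<close> of \<open>K\<close>. Evaluation at \<open>k\<close> has norm at most one, so \<open>x \<mapsto> G x k\<close> still attains its
  norm at \<open>p, q\<close> and is at least as close to \<open>F\<close>.\<close>

text \<open>The Lipschitz constant bounds the set of difference quotients, so its \<open>Sup\<close>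
  is a genuine upper bound.\<close>

lemma lip_norm_bound:
  assumes "L-lipschitz_on UNIV F"
  shows "norm (F p - F q) \<le> lip_norm F * dist p q"
proof (cases "p = q")
  case False
  have "bdd_above (insert 0 {norm (F p - F q) / dist p q | p q. p \<noteq> q})"
  proof (rule bdd_aboveI[of _ L])
    fix r assume "r \<in> insert 0 {norm (F p - F q) / dist p q | p q. p \<noteq> q}"
    then show "r \<le> L"
      using assms lipschitz_onD[OF assms] lipschitz_on_nonneg[OF assms]
      by (auto simp: dist_norm[symmetric] divide_le_eq)
  qed
  then have "norm (F p - F q) / dist p q \<le> lip_norm F"
    unfolding lip_norm_def using False by (intro cSup_upper) auto
  then show ?thesis
    using False by (simp add: divide_le_eq)
qed simp

lemma lip_norm_le:
  assumes "0 \<le> C" and "\<And>p q. norm (F p - F q) \<le> C * dist p q"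
  shows "lip_norm F \<le> C"
  unfolding lip_norm_def using assms by (intro cSup_least) (auto simp: divide_le_eq)

lemma lip_norm_nonneg:
  assumes "L-lipschitz_on UNIV F"
  shows "0 \<le> lip_norm F"
proof (cases "\<exists>p q :: 'a. p \<noteq> q")
  case True
  then obtain p q :: 'a where "p \<noteq> q"
    by blast
  moreover have "0 \<le> lip_norm F * dist p q"
    using lip_norm_bound[OF assms] norm_ge_zero order_trans by blast
  ultimately show ?thesis
    by (simp add: zero_le_mult_iff)
next
  case False
  \<comment> \<open>On a one-point space only the inserted \<open>0\<close> remains in the
    set.\<close>
  then show ?thesis
    by (simp add: lip_norm_def)
qed

text \<open>Meant for \<open>G\<close> obtained from \<open>F\<close> by evaluating at a point of
  \<open>K\<close>, which does not increase norms.\<close>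

lemma lip_norm_mono:
  assumes "L-lipschitz_on UNIV F"
    and "\<And>p q. norm (G p - G q) \<le> norm (F p - F q)"
  shows "lip_norm G \<le> lip_norm F"
  using assms lip_norm_bound[OF assms(1)]
  by (intro lip_norm_le lip_norm_nonneg[OF assms(1)]) (blast intro: order_trans)

text \<open>A continuous real function on a nonempty compact space has a maximum, and a pointwise
  bound on \<open>f\<close> also bounds its supremum norm.\<close>

lemma bcontfun_norm_attained:
  fixes f :: "'k::topological_space \<Rightarrow>\<^sub>C 'y::real_normed_vector"
  assumes "compact (UNIV :: 'k set)"
  obtains k where "norm (apply_bcontfun f k) = norm f"
proof -
  have "continuous_on UNIV (\<lambda>x. norm (apply_bcontfun f x))"
    by (intro continuous_on_norm continuous_on_apply_bcontfun)
  then obtain k where "\<And>x. norm (apply_bcontfun f x) \<le> norm (apply_bcontfun f k)"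
    using continuous_attains_sup[OF assms] by auto
  then have "norm (apply_bcontfun f k) = norm f"
    by (intro antisym norm_bounded norm_bound)
  then show thesis
    by (rule that)
qed

theorem proposition4p7:
  fixes z :: "'m::complete_space"
  assumes "compact (UNIV :: 'k::t2_space set)"
    and "dense_in_Lip0 z (LipSNA z :: ('m \<Rightarrow> ('k \<Rightarrow>\<^sub>C 'y::banach)) set)"
  shows "dense_in_Lip0 z (LipSNA z :: ('m \<Rightarrow> 'y) set)"
  unfolding dense_in_Lip0_def
proof (intro conjI ballI allI impI)
  show "LipSNA z \<subseteq> (Lip0 z :: ('m \<Rightarrow> 'y) set)"
    by (auto simp: LipSNA_def)
next
  fix F :: "'m \<Rightarrow> 'y" and e :: real
  assume "F \<in> Lip0 z" and "e > 0"
  then obtain L where F: "F z = 0" "L-lipschitz_on UNIV F"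
    by (auto simp: Lip0_def)
  define F' :: "'m \<Rightarrow> 'k \<Rightarrow>\<^sub>C 'y" where "F' x = const_bcontfun (F x)" for x
  have F'_apply: "apply_bcontfun (F' x) k = F x" for x k
    by (simp add: F'_def)
  have "dist (F' x) (F' y) \<le> L * dist x y" for x y
    using lipschitz_onD[OF F(2)] by (intro dist_bound) (simp add: F'_apply)
  then have F': "L-lipschitz_on UNIV F'"
    using lipschitz_on_nonneg[OF F(2)] by (intro lipschitz_onI)
  have "F' z = 0"
    using F(1) by (intro bcontfun_eqI) (simp add: F'_apply)
  with F' have "F' \<in> Lip0 z"
    by (auto simp: Lip0_def)
  with assms(2) \<open>e > 0\<close> obtain G where "G \<in> LipSNA z" and close: "lip_norm (\<lambda>x. F' x - G x) < e"
    unfolding dense_in_Lip0_def by blast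
  then obtain L' p q where G: "G z = 0" "L'-lipschitz_on UNIV G"
    and pq: "p \<noteq> q" "norm (G p - G q) / dist p q = lip_norm G"
    by (auto simp: LipSNA_def Lip0_def strongly_attains_norm_def)
  \<comment> \<open>The point \<open>k\<close> is tied to this one pair; for all other pairs the
    inequality \<open>g_diff\<close> is enough.\<close>
  obtain k where k: "norm (apply_bcontfun (G p - G q) k) = norm (G p - G q)"
    using bcontfun_norm_attained[OF assms(1)] .
  define g where "g x = apply_bcontfun (G x) k" for x
  have g_diff: "norm (g x - g y) \<le> norm (G x - G y)" for x y
    using norm_bounded[of "G x - G y" k] by (simp add: g_def)
  have "dist (g x) (g y) \<le> L' * dist x y" for x y
    using g_diff[of x y] lipschitz_onD[OF G(2), of x y] by (simp add: dist_norm)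
  then have g: "L'-lipschitz_on UNIV g"
    using lipschitz_on_nonneg[OF G(2)] by (intro lipschitz_onI)
  \<comment> \<open>No quotient is lost at \<open>p\<close>, \<open>q\<close>, so the norm of
    \<open>g\<close> cannot drop below that of \<open>G\<close>; \<open>g_diff\<close> gives the
    other inequality.\<close>
  have "lip_norm G = norm (g p - g q) / dist p q"
    using k pq(2) by (simp add: g_def)
  also have "\<dots> \<le> lip_norm g"
    using lip_norm_bound[OF g, of p q] pq(1) by (simp add: divide_le_eq)
  finally have "lip_norm g = lip_norm G"
    using lip_norm_mono[OF G(2) g_diff] by simp
  then have "strongly_attains_norm g"
    unfolding strongly_attains_norm_def using k pq by (intro exI[of _ p] exI[of _ q]) (simp add: g_def)
  moreover have "g \<in> Lip0 z"
    using G(1) g by (auto simp: Lip0_def g_def)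
  ultimately have "g \<in> LipSNA z"
    by (simp add: LipSNA_def)
  \<comment> \<open>Each \<open>F' x\<close> is constant with value \<open>F x\<close>, so
    evaluating \<open>F' x - G x\<close> at \<open>k\<close> gives \<open>F x - g x\<close>.\<close>
  moreover have "lip_norm (\<lambda>x. F x - g x) \<le> lip_norm (\<lambda>x. F' x - G x)"
  proof (rule lip_norm_mono)
    show "(L + L')-lipschitz_on UNIV (\<lambda>x. F' x - G x)"
      using F' G(2) by (rule lipschitz_on_diff)
    show "norm (F x - g x - (F y - g y)) \<le> norm (F' x - G x - (F' y - G y))" for x y
      using norm_bounded[of "F' x - G x - (F' y - G y)" k] by (simp add: g_def F'_apply)
  qed
  ultimately show "\<exists>G\<in>LipSNA z. lip_norm (\<lambda>x. F x - G x) < e"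
    using close by force
qed

end
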